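(* $$\zeta(2)=\sum_{n=1}^{\infty}\frac{1024\,n}{3(2n-1)^2(2n+1)(2n+3)^2}\cdot\frac{\binom{2n}{n}}{\binom{2n+2}{n+1}}.$$
   Context: $\zeta(s)=\sum_{n=1}^{\infty}\frac{1}{n^s}$ for $\Re(s)>1$; in particular $\zeta(2)=\sum_{n=1}^\infty \frac1{n^2}$. *)

theory Defs
  imports Complex_Main "HOL-Analysis.Complex_Transcendental"
begin

text \<open>
  The Dirichlet series of the Riemann zeta function; the value is meaningful only for
  \<open>Re s > 1\<close>, where the series converges. The index is shifted so that the sum starts at \<open>1\<close>.
\<close>
definition zeta :: "complex \<Rightarrow> complex" where
  "zeta s = (\<Sum>k. 1 / of_nat (Suc k) powr s)"

end

theory Submission
  imports Defs
begin

text \<open>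
  Since \<open>(2n choose n) / (2n+2 choose n+1) = (n+1) / (2(2n+1))\<close>, the summand is a rational
  function of \<open>n\<close>, and in terms of the odd number \<open>m = 2n+1\<close> it equals
  \<open>128(m\<^sup>2-1) / (3(m-2)\<^sup>2 m\<^sup>2 (m+2)\<^sup>2)\<close>. Its partial fraction decomposition is
  \<open>2/(m-2)\<^sup>2 - 8/(3m\<^sup>2) + 2/(m+2)\<^sup>2 - (1/(m-2) - 1/(m+2))/3\<close>.
  The coefficients of the three squares add up to \<open>4/3\<close>, so shifting the index turns the summand
  into \<open>4/3\<close> times a reciprocal odd square plus a telescoping difference \<open>g(k) - g(k+1)\<close>
  (lemma \<open>summand_eq_odd_square_plus_telescoping\<close>). The function \<open>g\<close> tends to \<open>0\<close>,
  and it also vanishes at the start, so the telescoping part contributes nothing. What remains is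
  \<open>4/3\<close> times the sum of the reciprocal odd squares, which is \<open>\<zeta>(2)\<close> because the even
  squares account for a quarter of \<open>\<zeta>(2)\<close> (lemma \<open>odd_reciprocal_powers_sums\<close>).
\<close>

lemma reciprocal_powers_sums_zeta:
  assumes "p \<ge> 2"
  shows "(\<lambda>k. complex_of_real (1 / real (Suc k) ^ p)) sums zeta (of_nat p)"
proof -
  have "summable (\<lambda>k. inverse (real (Suc k) ^ p))"
    using inverse_power_summable[OF assms, where 'a = real] by (subst summable_Suc_iff) simp
  then have "summable (\<lambda>k. complex_of_real (1 / real (Suc k) ^ p))"
    by (subst summable_of_real_iff) (simp add: inverse_eq_divide del: of_nat_Suc)
  moreover have "complex_of_real (1 / real (Suc k) ^ p) = 1 / of_nat (Suc k) powr of_nat p" for k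
    by (simp add: powr_nat' del: of_nat_Suc)
  ultimately show ?thesis
    unfolding zeta_def by (simp only: summable_sums)
qed

text \<open>
  Grouping the terms in pairs separates the odd denominators from the even ones, and the even ones
  reproduce the whole series scaled by \<open>1/2\<^sup>p\<close>. What is left is
  the series with its Euler factor at the prime \<open>2\<close> removed.
\<close>
lemma odd_reciprocal_powers_sums:
  fixes S :: "'a :: real_normed_field"
  assumes "(\<lambda>k. 1 / of_nat (Suc k) ^ p) sums S"
  shows "(\<lambda>k. 1 / of_nat (2 * k + 1) ^ p) sums ((1 - 1 / 2 ^ p) * S)"
proof -
  have "(\<lambda>k. \<Sum>j = k * 2..<k * 2 + 2. 1 / of_nat (Suc j) ^ p :: 'a) sums S"
    by (rule sums_group[OF assms]) simp
  moreover have "(\<Sum>j = k * 2..<k * 2 + 2. 1 / of_nat (Suc j) ^ p :: 'a)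
      = 1 / of_nat (2 * k + 1) ^ p + 1 / 2 ^ p * (1 / of_nat (Suc k) ^ p)" for k
  proof -
    have "{k * 2..<k * 2 + 2} = {2 * k, 2 * k + 1}" by auto
    moreover have "(of_nat (Suc (2 * k + 1)) :: 'a) = 2 * of_nat (Suc k)" by simp
    ultimately show ?thesis
      by (simp add: power_mult_distrib del: of_nat_Suc)
  qed
  ultimately have
    "(\<lambda>k. 1 / of_nat (2 * k + 1) ^ p + 1 / 2 ^ p * (1 / of_nat (Suc k) ^ p)) sums S"
    by simp
  from sums_diff[OF this sums_mult[OF assms, of "1 / 2 ^ p"]] show ?thesis
    by (simp add: algebra_simps)
qed

lemma central_binomial_ratio:
  "real ((2 * n) choose n) / real ((2 * n + 2) choose (n + 1))
     = (real n + 1) / (2 * (2 * real n + 1))"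
proof -
  have "(n + 1) * ((2 * n + 2) choose (n + 1)) = 2 * (n + 1) * ((2 * n + 1) choose n)"
    using Suc_times_binomial[of n "2 * n + 1"] by simp
  moreover have "(n + 1) * ((2 * n + 1) choose n) = (2 * n + 1) * ((2 * n) choose n)"
    using binomial_absorb_comp[of "2 * n + 1" n] by simp
  ultimately have "(n + 1) * ((2 * n + 2) choose (n + 1)) = 2 * (2 * n + 1) * ((2 * n) choose n)"
    by (simp only: mult.assoc)
  then have "real ((n + 1) * ((2 * n + 2) choose (n + 1)))
      = real (2 * (2 * n + 1) * ((2 * n) choose n))"
    by (rule arg_cong)
  then have "(real n + 1) * real ((2 * n + 2) choose (n + 1))
      = 2 * (2 * real n + 1) * real ((2 * n) choose n)"
    by (simp only: of_nat_mult of_nat_add of_nat_1 of_nat_numeral)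
  moreover have "real ((2 * n + 2) choose (n + 1)) > 0"
    by (subst of_nat_0_less_iff, rule zero_less_binomial) simp
  moreover have "2 * (2 * real n + 1) > 0" by simp
  ultimately show ?thesis
    by (metis frac_eq_eq less_irrefl mult.commute)
qed

text \<open>The function \<open>g\<close> whose differences \<open>g(k) - g(k+1)\<close> occur in the summand; it is read off
  from the partial fractions by the regrouping in the next lemma.\<close>
definition telescoper :: "nat \<Rightarrow> real" where
  "telescoper k = 2 / 3 * (1 / real (2 * k + 1) ^ 2) - 2 * (1 / real (2 * k + 3) ^ 2)
     - 1 / 3 * (1 / real (2 * k + 1) + 1 / real (2 * k + 3))"

text \<open>
  With \<open>m = 2k+3\<close>, and with \<open>a, b, c\<close> the reciprocals of \<open>m-2, m, m+2\<close>, the squares in the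
  partial fractions are regrouped as
  \<open>2a\<^sup>2 - 8/3 b\<^sup>2 + 2c\<^sup>2 = 4/3 a\<^sup>2 + (2/3 a\<^sup>2 - 2b\<^sup>2) - (2/3 b\<^sup>2 - 2c\<^sup>2)\<close>, and \<open>1/(m-2) - 1/(m+2)\<close> as
  \<open>(1/(m-2) + 1/m) - (1/m + 1/(m+2))\<close>. In the proof \<open>a\<close>, \<open>b\<close> and \<open>c\<close>
  are variables, so that the claim becomes a polynomial identity modulo their defining relations.
\<close>
lemma summand_eq_odd_square_plus_telescoping:
  assumes "n = Suc k"
  shows "1024 * real n / (3 * (2 * real n - 1)^2 * (2 * real n + 1) * (2 * real n + 3)^2)
          * (real ((2 * n) choose n) / real ((2 * n + 2) choose (n + 1)))
       = 4 / 3 * (1 / real (2 * k + 1) ^ 2) + (telescoper k - telescoper (Suc k))"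
proof -
  define x where "x = real k"
  have "x \<ge> 0" by (simp add: x_def)
  define a b c where abc: "a = 1 / (2 * x + 1)" "b = 1 / (2 * x + 3)" "c = 1 / (2 * x + 5)"
  have "a * (2 * x + 1) = 1" "b * (2 * x + 3) = 1" "c * (2 * x + 5) = 1"
    using \<open>x \<ge> 0\<close> by (simp_all add: abc)
  then have "512 / 3 * (x + 1) * (x + 2) * a^2 * b^2 * c^2
      = 4 / 3 * a^2 + ((2 / 3 * a^2 - 2 * b^2 - 1 / 3 * (a + b))
         - (2 / 3 * b^2 - 2 * c^2 - 1 / 3 * (b + c)))"
    by algebra
  moreover have "1024 * (x + 1) / (3 * (2 * x + 1)^2 * (2 * x + 3) * (2 * x + 5)^2)
        * ((x + 2) / (2 * (2 * x + 3))) = 512 / 3 * (x + 1) * (x + 2) * a^2 * b^2 * c^2"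
  proof -
    have "1024 * u / (3 * A^2 * B * C^2) * (v / (2 * B))
        = 512 / 3 * u * v * (1 / A)^2 * (1 / B)^2 * (1 / C)^2" for u v A B C :: real
      by (simp add: power2_eq_square)
    then show ?thesis unfolding abc .
  qed
  moreover have "real k = x" "2 * real (Suc k) - 1 = 2 * x + 1" "2 * real (Suc k) + 1 = 2 * x + 3"
      "2 * real (Suc k) + 3 = 2 * x + 5" "real (Suc k) = x + 1" "real (Suc k) + 1 = x + 2"
    by (simp_all add: x_def)
  moreover have "1 / real (2 * k + 1) = a" "1 / real (2 * k + 3) = b"
      "1 / real (2 * Suc k + 1) = b" "1 / real (2 * Suc k + 3) = c"
    by (simp_all add: abc x_def add.commute)
  ultimately show ?thesis
    unfolding central_binomial_ratio telescoper_def assms power_one_over[symmetric] by (simp only:)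
qed

lemma telescoper_tendsto_0: "telescoper \<longlonglongrightarrow> 0"
proof -
  have "(\<lambda>k. 1 / real (2 * k + c)) \<longlonglongrightarrow> 0" if "c > 0" for c
  proof -
    have "strict_mono (\<lambda>k. 2 * k + c)" by (auto simp: strict_mono_def)
    from LIMSEQ_subseq_LIMSEQ[OF lim_1_over_n this] show ?thesis by (simp add: o_def)
  qed
  from this[of 1] this[of 3]
  have "(\<lambda>k. 2 / 3 * (1 / real (2 * k + 1)) ^ 2 - 2 * (1 / real (2 * k + 3)) ^ 2
     - 1 / 3 * (1 / real (2 * k + 1) + 1 / real (2 * k + 3)))
     \<longlonglongrightarrow> 2 / 3 * 0 ^ 2 - 2 * 0 ^ 2 - 1 / 3 * (0 + 0)"
    by (intro tendsto_intros) simp_all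
  then show ?thesis
    by (simp add: telescoper_def[abs_def] power_one_over)
qed

theorem theorem2p5:
  "(\<lambda>k. let n = Suc k in
      complex_of_real
        (1024 * real n / (3 * (2 * real n - 1)^2 * (2 * real n + 1) * (2 * real n + 3)^2)
          * (real ((2 * n) choose n) / real ((2 * n + 2) choose (n + 1)))))
    sums zeta 2"
proof -
  have "(\<lambda>k. 1 / of_nat (Suc k) ^ 2) sums zeta 2"
    using reciprocal_powers_sums_zeta[of 2] by (simp del: of_nat_Suc)
  from sums_mult[OF odd_reciprocal_powers_sums[OF this], of "4 / 3"]
  have "(\<lambda>k. complex_of_real (4 / 3 * (1 / real (2 * k + 1) ^ 2))) sums zeta 2"
    by simp
  moreover have "telescoper 0 = 0"
    by (simp add: telescoper_def power2_eq_square)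
  then have "(\<lambda>k. telescoper k - telescoper (Suc k)) sums 0"
    using telescope_sums'[OF telescoper_tendsto_0] by simp
  from sums_of_real[OF this]
  have "(\<lambda>k. complex_of_real (telescoper k - telescoper (Suc k))) sums 0"
    by (simp only: of_real_0)
  ultimately have "(\<lambda>k. complex_of_real (4 / 3 * (1 / real (2 * k + 1) ^ 2))
      + complex_of_real (telescoper k - telescoper (Suc k))) sums (zeta 2 + 0)"
    by (rule sums_add)
  then show ?thesis
    unfolding Let_def summand_eq_odd_square_plus_telescoping[OF refl] of_real_add add_0_right .
qed

end
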